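(* Let $T$ be a set of transpositions in the symmetric group $S_n$ such that $G_T$ is a generalized complete multipartite graph of type $k$, for some positive integer $k$. Then $\mathrm{Cay}(S_n,T)$ is integral.
   Context: $S_n$ is the symmetric group on $[n]=\{1,\dots,n\}$. For a group $G$ and an inverse-closed subset $S\subseteq G$ not containing the identity, $\mathrm{Cay}(G,S)$ is the graph with vertex set $G$ in which $g_1,g_2$ are adjacent if and only if $g_1g_2^{-1}\in S$. For a set $T$ of transpositions in $S_n$, $G_T$ is the graph with vertex set $[n]$ in which $i,j$ are adjacent if and only if $(i,j)\in T$. A finite simple graph is integral if all eigenvalues of its adjacency matrix are integers. For a graph $G$, $G^\#$ denotes the induced subgraph of $G$ on the set of non-isolated vertices of $G$. The join $\Gamma_1*\dots*\Gamma_k$ of vertex-disjoint graphs is their disjoint union together with all edges between vertices of $\Gamma_i$ and vertices of $\Gamma_j$ for all $i\ne j$. Weak joins: let $G_1,\dots,G_k$, $k\ge 2$, be graphs with the same vertex set. A graph $G$ is a weakly join of $G_1,\dots,G_k$, written $G\in\mathcal{WJ}(G_1,\dots,G_k)$, if there exist subgraphs $\Gamma_i$ of $G_i$ ($1\le i\le k$) such that (1) $E(\Gamma_i)=E(G_i)$ for every $i$; (2) $V(\Gamma_i)\cap V(\Gamma_j)=\varnothing$ for all $i\ne j$; (3) $G^\#=\Gamma_1*\dots*\Gamma_k$. Generalized complete multipartite graphs (recursive definition): a graph $\Gamma$ is a generalized complete multipartite graph of type $1$ if $\Gamma\in\mathcal{WJ}(\Gamma_1,\dots,\Gamma_k)$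 for some graphs $\Gamma_1,\dots,\Gamma_k$ with the same vertex set, each of which is a disjoint union of complete multipartite graphs. For $m\ge 2$, $\Gamma$ is a generalized complete multipartite graph of type $m$ if $\Gamma\in\mathcal{WJ}(\Gamma_1,\dots,\Gamma_k)$ for some graphs $\Gamma_1,\dots,\Gamma_k$ with the same vertex set, each of which is a disjoint union of generalized complete multipartite graphs of type at most $m-1$. *)

theory Defs
  imports
    "HOL-Library.Disjoint_Sets"
    "HOL-Algebra.Sym_Groups"
    "Graph_Theory.Graph_Theory"
    "Jordan_Normal_Form.Spectral_Radius"
begin

text \<open>
  A finite simple graph is a \<^locale>\<open>pair_graph\<close>: a finite vertex set with a symmetric,
  irreflexive set of arcs, the edge between \<open>u\<close> and \<open>v\<close> being the two arcs \<open>(u, v)\<close> and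
  \<open>(v, u)\<close>.  The graph without vertices is a graph.
\<close>

definition cayley_graph :: "('a, 'm) monoid_scheme \<Rightarrow> 'a set \<Rightarrow> 'a pair_pre_digraph" where
  "cayley_graph G S =
     \<lparr>pverts = carrier G,
      parcs = {(g, h). g \<in> carrier G \<and> h \<in> carrier G \<and> g \<otimes>\<^bsub>G\<^esub> inv\<^bsub>G\<^esub> h \<in> S}\<rparr>"

definition transpositions :: "nat \<Rightarrow> (nat \<Rightarrow> nat) set" where
  "transpositions n = {Transposition.transpose i j | i j. i \<in> {1..n} \<and> j \<in> {1..n} \<and> i \<noteq> j}"

definition transposition_graph :: "nat \<Rightarrow> (nat \<Rightarrow> nat) set \<Rightarrow> nat pair_pre_digraph" where
  "transposition_graph n T =
     \<lparr>pverts = {1..n},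
      parcs = {(i, j). i \<in> {1..n} \<and> j \<in> {1..n} \<and> i \<noteq> j \<and> Transposition.transpose i j \<in> T}\<rparr>"

text \<open>The adjacency matrix depends on an enumeration \<open>vs\<close> of the vertices.\<close>

definition adjacency_matrix :: "'a pair_pre_digraph \<Rightarrow> 'a list \<Rightarrow> complex mat" where
  "adjacency_matrix G vs =
     mat (length vs) (length vs) (\<lambda>(i, j). if (vs ! i, vs ! j) \<in> parcs G then 1 else 0)"

definition integral_graph :: "'a pair_pre_digraph \<Rightarrow> bool" where
  "integral_graph G \<longleftrightarrow>
     pair_graph G \<and>
     (\<forall>vs. distinct vs \<and> set vs = pverts G \<longrightarrow> spectrum (adjacency_matrix G vs) \<subseteq> \<int>)"

definition non_isolated :: "'a pair_pre_digraph \<Rightarrow> 'a set" where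
  "non_isolated G = {v \<in> pverts G. \<exists>w \<in> pverts G. (v, w) \<in> parcs G}"

definition non_isolated_subgraph :: "'a pair_pre_digraph \<Rightarrow> 'a pair_pre_digraph" where
  "non_isolated_subgraph G =
     \<lparr>pverts = non_isolated G,
      parcs = {(u, v) \<in> parcs G. u \<in> non_isolated G \<and> v \<in> non_isolated G}\<rparr>"

lemma with_proj_non_isolated_subgraph:
  "with_proj (non_isolated_subgraph G) = with_proj G \<restriction> non_isolated G"
  by (auto simp: non_isolated_subgraph_def induce_subgraph_def with_proj_def)

definition vertex_disjoint :: "'a pair_pre_digraph list \<Rightarrow> bool" where
  "vertex_disjoint Gs \<longleftrightarrow> disjoint_family_on (\<lambda>i. pverts (Gs ! i)) {..<length Gs}"

text \<open>The following two operations are meant for vertex-disjoint graphs only.\<close>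

definition graph_union :: "'a pair_pre_digraph list \<Rightarrow> 'a pair_pre_digraph" where
  "graph_union Gs = \<lparr>pverts = (\<Union>G\<in>set Gs. pverts G), parcs = (\<Union>G\<in>set Gs. parcs G)\<rparr>"

definition graph_join :: "'a pair_pre_digraph list \<Rightarrow> 'a pair_pre_digraph" where
  "graph_join Gs =
     \<lparr>pverts = pverts (graph_union Gs),
      parcs = parcs (graph_union Gs) \<union>
        {(u, v). \<exists>i<length Gs. \<exists>j<length Gs. i \<noteq> j \<and> u \<in> pverts (Gs ! i) \<and> v \<in> pverts (Gs ! j)}\<rparr>"

definition disjoint_union_of :: "('a pair_pre_digraph \<Rightarrow> bool) \<Rightarrow> 'a pair_pre_digraph \<Rightarrow> bool" where
  "disjoint_union_of P G \<longleftrightarrow>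
     (\<exists>Cs. (\<forall>C\<in>set Cs. P C) \<and> vertex_disjoint Cs \<and> G = graph_union Cs)"

lemma disjoint_union_of_mono [mono]:
  "(\<And>C. P C \<longrightarrow> Q C) \<Longrightarrow> disjoint_union_of P G \<longrightarrow> disjoint_union_of Q G"
  unfolding disjoint_union_of_def by blast

text \<open>
  The number of parts is arbitrary; in particular, graphs with a single part, such as an isolated
  vertex, are complete multipartite.
\<close>

definition complete_multipartite :: "'a pair_pre_digraph \<Rightarrow> bool" where
  "complete_multipartite G \<longleftrightarrow>
     pair_graph G \<and>
     (\<exists>P. partition_on (pverts G) P \<and>
          parcs G = {(u, v). \<exists>A\<in>P. \<exists>B\<in>P. A \<noteq> B \<and> u \<in> A \<and> v \<in> B})"

definition weak_join :: "'a pair_pre_digraph \<Rightarrow> 'a pair_pre_digraph list \<Rightarrow> bool" where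
  "weak_join G Gs \<longleftrightarrow>
     pair_graph G \<and> 2 \<le> length Gs \<and>
     (\<forall>H\<in>set Gs. pair_graph H) \<and> (\<forall>H\<in>set Gs. \<forall>H'\<in>set Gs. pverts H = pverts H') \<and>
     (\<exists>\<Gamma>s. length \<Gamma>s = length Gs \<and>
           (\<forall>i<length Gs. pair_graph (\<Gamma>s ! i) \<and> subgraph (\<Gamma>s ! i) (Gs ! i) \<and>
                          parcs (\<Gamma>s ! i) = parcs (Gs ! i)) \<and>
           vertex_disjoint \<Gamma>s \<and>
           non_isolated_subgraph G = graph_join \<Gamma>s)"

inductive gen_complete_multipartite :: "nat \<Rightarrow> 'a pair_pre_digraph \<Rightarrow> bool" where
  type_one:
    "gen_complete_multipartite 1 G"
    if "weak_join G Gs" and "\<forall>H\<in>set Gs. disjoint_union_of complete_multipartite H"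
| type_ge_two:
    "gen_complete_multipartite m G"
    if "2 \<le> m" and "weak_join G Gs"
      and "\<forall>H\<in>set Gs. disjoint_union_of
             (\<lambda>C. \<exists>l. 1 \<le> l \<and> l \<le> m - 1 \<and> gen_complete_multipartite l C) H"

end

theory Submission
  imports
    Defs
    "HOL-Library.Function_Algebras"
    "HOL-Computational_Algebra.Fundamental_Theorem_Algebra"
begin

text \<open>
  An eigenvector of \<open>Cay(S\<^sub>n, T)\<close> is a function \<open>f\<close> on \<open>S\<^sub>n\<close> that is an eigenvector of
  \<open>L(G\<^sub>T)\<close>, where \<open>(L(G) f) g\<close> is the sum of \<open>f ((i j) g)\<close> over the edges \<open>ij\<close> of \<open>G\<close>.  Sums and
  differences of commuting operators with integer eigenvalues have integer eigenvalues, because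
  commuting operators have a common eigenvector in each eigenspace of either.
  For the complete graph \<open>K(V)\<close>, \<open>L(K(V))\<close> is central among the operators on edges inside \<open>V\<close> and
  is a sum of Jucys--Murphy elements (the stars), which commute.  If \<open>s = (y x)\<close> then consecutive
  ones satisfy \<open>Y = s X s + s\<close>, so an eigenvalue of \<open>Y\<close> is either an eigenvalue of \<open>X\<close> or differs
  from one by 1; hence all are integers.  Finally, for a join of graphs \<open>G\<^sub>i\<close> on disjoint sets
  \<open>V\<^sub>i\<close> with union \<open>V\<close>, \<open>L\<close> equals \<open>L(K(V)) + \<Sum>\<^sub>i (L(G\<^sub>i) - L(K(V\<^sub>i)))\<close>, a combination of commuting
  operators, so that integrality passes from the \<open>G\<^sub>i\<close> to the join, as it does to disjoint unions.
\<close>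

section \<open>Commuting operators with integer eigenvalues\<close>

locale complex_vector_space = vector_space scale
  for scale :: "complex \<Rightarrow> 'b::ab_group_add \<Rightarrow> 'b" (infixr "*s" 75)
begin

text \<open>Horner's scheme for p(Y) v. Fixing the vector \<open>v\<close> keeps everything inside
  the space, with no algebra of operators to form.\<close>

definition poly_op :: "complex poly \<Rightarrow> ('b \<Rightarrow> 'b) \<Rightarrow> 'b \<Rightarrow> 'b" where
  "poly_op p Y v = fold_coeffs (\<lambda>a w. a *s v + Y w) p 0"

lemma poly_op_0 [simp]: "poly_op 0 Y v = 0"
  by (simp add: poly_op_def)

context
  fixes Y :: "'b \<Rightarrow> 'b"
  assumes lin: "Vector_Spaces.linear scale scale Y"
begin

interpretation Y: Vector_Spaces.linear scale scale Y
  by (rule lin)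

lemma poly_op_pCons [simp]: "poly_op (pCons a p) Y v = a *s v + Y (poly_op p Y v)"
  by (cases "a = 0 \<and> p = 0") (auto simp: poly_op_def Y.zero)

lemma poly_op_add: "poly_op (p + q) Y v = poly_op p Y v + poly_op q Y v"
  by (induction p q rule: poly_induct2) (auto simp: Y.add scale_left_distrib algebra_simps)

lemma poly_op_smult: "poly_op (Polynomial.smult c p) Y v = c *s poly_op p Y v"
  by (induction p) (auto simp: Y.scale scale_right_distrib)

lemma poly_op_linear_factor_mult:
  "poly_op ([:- a, 1:] * q) Y v = Y (poly_op q Y v) - a *s poly_op q Y v"
proof -
  have "[:- a, 1:] * q = Polynomial.smult (- a) q + pCons 0 q"
    by simp
  then show ?thesis
    by (simp only: poly_op_add poly_op_smult poly_op_pCons) simp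
qed

lemma poly_op_monom: "poly_op (Polynomial.monom c i) Y v = c *s (Y ^^ i) v"
  by (induction i) (auto simp: monom_0 monom_Suc Y.scale Y.zero)

lemma poly_op_sum: "poly_op (\<Sum>i\<in>I. p i) Y v = (\<Sum>i\<in>I. poly_op (p i) Y v)"
  by (induction I rule: infinite_finite_induct) (auto simp: poly_op_add)

lemma poly_op_closed:
  assumes "subspace W" "v \<in> W" "\<And>w. w \<in> W \<Longrightarrow> Y w \<in> W"
  shows "poly_op p Y v \<in> W"
  using assms by (induction p) (auto simp: subspace_0 subspace_add subspace_scale)

text \<open>The iterates v, Y v, Y^2 v, ... stay in the span of \<open>D\<close>, so the first
  \<open>card D + 1\<close> of them satisfy a nontrivial linear relation, which is a polynomial in Y
  applied to v.\<close>

lemma annihilating_poly: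
  assumes D: "finite D" "v \<in> span D" "\<And>w. w \<in> span D \<Longrightarrow> Y w \<in> span D"
  shows "\<exists>p. p \<noteq> 0 \<and> poly_op p Y v = 0"
proof -
  define u where "u i = (Y ^^ i) v" for i
  have u: "u i \<in> span D" for i
    by (induction i) (auto simp: u_def D)
  show ?thesis
  \<comment> \<open>\<open>dependent\<close> speaks of sets, so a repeated iterate has to be treated
    apart: it gives a difference of two monomials. Without repetitions the set has
    \<open>card D + 1\<close> elements, too many to be independent.\<close>
  proof (cases "inj_on u {..card D}")
    case False
    then obtain i j where ij: "i \<noteq> j" "u i = u j"
      by (auto simp: inj_on_def)
    have "Polynomial.coeff (Polynomial.monom 1 i + Polynomial.monom (- 1) j) i = (1 :: complex)"
      using ij by simp
    then have "Polynomial.monom 1 i + Polynomial.monom (- 1) j \<noteq> (0 :: complex poly)"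
      by (metis coeff_0 zero_neq_one)
    moreover have "poly_op (Polynomial.monom 1 i + Polynomial.monom (- 1) j) Y v = 0"
      using ij(2) by (simp add: poly_op_add poly_op_monom u_def)
    ultimately show ?thesis
      by blast
  next
    case inj: True
    have "dependent (u ` {..card D})"
    proof (rule ccontr)
      assume "\<not> dependent (u ` {..card D})"
      then have "card (u ` {..card D}) \<le> card D"
        using u D(1) by (intro conjunct2[OF independent_span_bound]) auto
      then show False
        using inj by (simp add: card_image)
    qed
    then obtain c i where c: "i \<le> card D" "c (u i) \<noteq> 0" "(\<Sum>w\<in>u ` {..card D}. c w *s w) = 0"
      by (auto simp: dependent_finite)
    define p where "p = (\<Sum>i\<le>card D. Polynomial.monom (c (u i)) i)"
    have "Polynomial.coeff p i = c (u i)"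
      using c(1) by (simp add: p_def coeff_sum)
    then have "p \<noteq> 0"
      using c(2) by auto
    moreover have "poly_op p Y v = 0"
      using c(3) sum.reindex[OF inj, of "\<lambda>w. c w *s w"]
      by (simp add: p_def poly_op_sum poly_op_monom flip: u_def)
    ultimately show ?thesis
      by blast
  qed
qed

text \<open>Split a linear factor X - a off \<open>p\<close>, leaving q. Either q(Y) v = 0 and q is
  an annihilating polynomial of smaller degree, or q(Y) v is an eigenvector for a, and it lies in
  the invariant subspace \<open>W\<close>.\<close>

lemma eigenvector_in_subspace_if_annihilated:
  assumes "p \<noteq> 0" "poly_op p Y v = 0" "v \<noteq> 0"
    and W: "subspace W" "v \<in> W" "\<And>w. w \<in> W \<Longrightarrow> Y w \<in> W"
  shows "\<exists>w\<in>W. \<exists>a. w \<noteq> 0 \<and> Y w = a *s w"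
  using assms(1-3)
proof (induction "Polynomial.degree p" arbitrary: p)
  case 0
  then obtain a where "p = [:a:]" "a \<noteq> 0"
    by (metis degree_eq_zeroE pCons_0_0)
  then show ?case
    using 0 by (simp add: Y.zero)
next
  case (Suc n)
  have "\<not> constant (poly p)"
    using Suc.hyps(2) by (simp add: constant_degree)
  then obtain a where "poly p a = 0"
    using fundamental_theorem_of_algebra by blast
  then obtain q where q: "p = [:- a, 1:] * q"
    by (auto simp: poly_eq_0_iff_dvd elim: dvdE)
  then have "q \<noteq> 0"
    using Suc.prems by auto
  show ?case
  proof (cases "poly_op q Y v = 0")
    case True
    have "n = Polynomial.degree q"
      using Suc.hyps(2) \<open>q \<noteq> 0\<close> degree_mult_eq[of "[:- a, 1:]" q] q by simp
    then show ?thesis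
      using Suc.hyps(1) \<open>q \<noteq> 0\<close> True Suc.prems by blast
  next
    case False
    have "Y (poly_op q Y v) = a *s poly_op q Y v"
      using Suc.prems(2) unfolding q poly_op_linear_factor_mult by simp
    then show ?thesis
      using False poly_op_closed[OF W] by blast
  qed
qed

end

end

section \<open>Integral operators on a locally finite space\<close>

locale locally_finite_space = complex_vector_space scale
  for scale :: "complex \<Rightarrow> 'b::ab_group_add \<Rightarrow> 'b" (infixr "*s" 75) +
  fixes orb :: "'b \<Rightarrow> 'b set"
  assumes finite_orb: "finite (orb v)" and in_orb: "v \<in> orb v"
begin

text \<open>Each vector lies in the finite-dimensional subspace \<open>span (orb v)\<close>, which
  every adapted operator preserves. This stands in for finite dimension of the whole space.\<close>

definition adapted :: "('b \<Rightarrow> 'b) \<Rightarrow> bool" where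
  "adapted X \<longleftrightarrow> Vector_Spaces.linear scale scale X \<and> (\<forall>v. \<forall>w\<in>orb v. X w \<in> span (orb v))"

definition integral_op :: "('b \<Rightarrow> 'b) \<Rightarrow> bool" where
  "integral_op X \<longleftrightarrow> adapted X \<and> (\<forall>v c. v \<noteq> 0 \<longrightarrow> X v = c *s v \<longrightarrow> c \<in> \<int>)"

lemma adapted_linear: "adapted X \<Longrightarrow> Vector_Spaces.linear scale scale X"
  by (simp add: adapted_def)

lemma integral_op_adapted: "integral_op X \<Longrightarrow> adapted X"
  by (simp add: integral_op_def)

lemma integral_op_eigenvalue: "integral_op X \<Longrightarrow> v \<noteq> 0 \<Longrightarrow> X v = c *s v \<Longrightarrow> c \<in> \<int>"
  by (simp add: integral_op_def)

lemma adapted_span: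
  assumes "adapted X" "w \<in> span (orb v)"
  shows "X w \<in> span (orb v)"
proof -
  interpret X: Vector_Spaces.linear scale scale X
    using assms(1) by (rule adapted_linear)
  show ?thesis
    using assms(2)
  proof (induction rule: span_induct_alt)
    case base
    then show ?case by (simp add: X.zero span_zero)
  next
    case (step c x y)
    then show ?case
      using assms(1) by (auto simp: X.add X.scale adapted_def intro: span_add span_scale)
  qed
qed

lemma adapted_zero: "adapted (\<lambda>v. 0)"
  unfolding adapted_def using module_hom_zero by (auto simp: span_zero Vector_Spaces.linear_iff vector_space_axioms)

lemma adapted_add:
  assumes "adapted X" "adapted Y"
  shows "adapted (\<lambda>v. X v + Y v)"
  using assms by (auto simp: adapted_def span_add Vector_Spaces.linear_iff algebra_simps)

lemma adapted_diff:
  assumes "adapted X" "adapted Y"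
  shows "adapted (\<lambda>v. X v - Y v)"
  using assms by (auto simp: adapted_def span_diff Vector_Spaces.linear_iff algebra_simps)

text \<open>As the operators commute, \<open>Y\<close> preserves the eigenspace of \<open>X\<close>
  for \<open>c\<close>. Some polynomial in \<open>Y\<close> annihilates \<open>v\<close>, since the
  iterates of \<open>v\<close> under \<open>Y\<close> remain in \<open>span (orb v)\<close>; hence
  \<open>Y\<close> has an eigenvector in that eigenspace.\<close>

lemma common_eigenvector:
  assumes X: "Vector_Spaces.linear scale scale X" and Y: "adapted Y"
    and comm: "\<And>v. X (Y v) = Y (X v)"
    and v: "v \<noteq> 0" "X v = c *s v"
  obtains w a where "w \<noteq> 0" "X w = c *s w" "Y w = a *s w"
proof -
  interpret X: Vector_Spaces.linear scale scale X
    by (rule X)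
  note Y' = adapted_linear[OF Y]
  interpret Y: Vector_Spaces.linear scale scale Y
    by (rule Y')
  obtain p where p: "p \<noteq> 0" "poly_op p Y v = 0"
    using annihilating_poly[OF Y' finite_orb] adapted_span[OF Y] in_orb span_base by metis
  have "subspace {w. X w = c *s w}"
    by (auto simp: subspace_def X.zero X.add X.scale scale_right_distrib mult.commute)
  moreover have "X (Y w) = c *s Y w" if "X w = c *s w" for w
    using that by (simp add: comm Y.scale)
  ultimately show ?thesis
    using eigenvector_in_subspace_if_annihilated[OF Y' p v(1), of "{w. X w = c *s w}"] v(2) that
    by auto
qed

lemma integral_op_add:
  assumes X: "integral_op X" and Y: "integral_op Y" and comm: "\<And>v. X (Y v) = Y (X v)"
  shows "integral_op (\<lambda>v. X v + Y v)"
  unfolding integral_op_def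
proof (intro conjI allI impI)
  show ad: "adapted (\<lambda>v. X v + Y v)"
    using X Y by (intro adapted_add integral_op_adapted)
  interpret X: Vector_Spaces.linear scale scale X
    using X by (intro adapted_linear integral_op_adapted)
  fix v c assume v: "v \<noteq> 0" "X v + Y v = c *s v"
  \<comment> \<open>X commutes with X + Y, so a common eigenvector of these two exists; on it Y acts
    as c - a.\<close>
  obtain w a where w: "w \<noteq> 0" "X w + Y w = c *s w" "X w = a *s w"
    by (rule common_eigenvector[OF adapted_linear[OF ad] integral_op_adapted[OF X] _ v])
      (auto simp: X.add comm)
  have "Y w = (c - a) *s w"
    using w by (simp add: scale_left_diff_distrib algebra_simps)
  then have "a \<in> \<int>" "c - a \<in> \<int>"
    using w X Y by (auto simp: integral_op_def)
  then show "c \<in> \<int>"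
    by (metis Ints_add add.commute diff_add_cancel)
qed

lemma integral_op_uminus:
  assumes "integral_op X"
  shows "integral_op (\<lambda>v. - X v)"
  unfolding integral_op_def
proof (intro conjI allI impI)
  show "adapted (\<lambda>v. - X v)"
    using adapted_diff[OF adapted_zero integral_op_adapted[OF assms]] by simp
  fix v c assume v: "v \<noteq> 0" "- X v = c *s v"
  then have "X v = (- c) *s v"
    by (metis minus_minus scale_minus_left)
  then have "- c \<in> \<int>"
    using v assms unfolding integral_op_def by blast
  then show "c \<in> \<int>"
    by simp
qed

lemma integral_op_diff:
  assumes X: "integral_op X" and Y: "integral_op Y" and comm: "\<And>v. X (Y v) = Y (X v)"
  shows "integral_op (\<lambda>v. X v - Y v)"
proof -
  interpret X: Vector_Spaces.linear scale scale X
    using X by (intro adapted_linear integral_op_adapted)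
  show ?thesis
    using integral_op_add[OF X integral_op_uminus[OF Y]] by (simp add: X.neg comm)
qed

lemma integral_op_zero: "integral_op (\<lambda>v. 0)"
  using adapted_zero by (auto simp: integral_op_def)

lemma integral_op_sum:
  assumes "finite I" "\<And>i. i \<in> I \<Longrightarrow> integral_op (X i)"
    and "\<And>i j v. i \<in> I \<Longrightarrow> j \<in> I \<Longrightarrow> X i (X j v) = X j (X i v)"
  shows "integral_op (\<lambda>v. \<Sum>i\<in>I. X i v)"
  using assms
proof (induction I rule: finite_induct)
  case empty
  then show ?case by (simp add: integral_op_zero)
next
  case (insert k I)
  interpret X: Vector_Spaces.linear scale scale "X k"
    using insert.prems by (intro adapted_linear integral_op_adapted) auto
  have "integral_op (\<lambda>v. X k v + (\<Sum>i\<in>I. X i v))"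
    using insert by (intro integral_op_add) (auto simp: X.sum intro!: sum.cong)
  then show ?case
    using insert by simp
qed

text \<open>
  The relation between \<open>X\<close> and \<open>Y\<close> is the one between consecutive Jucys--Murphy elements.
\<close>

lemma integral_op_conjugate_add:
  assumes X: "integral_op X" and Y: "adapted Y" and s: "Vector_Spaces.linear scale scale s"
    and invol: "\<And>v. s (s v) = v"
    and Y_eq: "\<And>v. Y v = s (X (s v)) + s v"
    and comm: "\<And>v. X (Y v) = Y (X v)"
  shows "integral_op Y"
  unfolding integral_op_def
proof (intro conjI allI impI Y)
  interpret X: Vector_Spaces.linear scale scale X
    using X by (intro adapted_linear integral_op_adapted)
  interpret s: Vector_Spaces.linear scale scale s
    by (rule s)
  fix v b assume v: "v \<noteq> 0" "Y v = b *s v"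
  obtain w a where w: "w \<noteq> 0" "Y w = b *s w" "X w = a *s w"
    by (rule common_eigenvector[OF adapted_linear[OF Y] integral_op_adapted[OF X] _ v])
      (auto simp: comm)
  have "a \<in> \<int>"
    using w X by (auto simp: integral_op_def)
  show "b \<in> \<int>"
  proof (cases "a = b")
    case True
    then show ?thesis using \<open>a \<in> \<int>\<close> by simp
  next
    case False
    \<comment> \<open>The relation between X and Y multiplied by s from the left: s Y = X s +
      1.\<close>
    have "s (Y w) = X (s w) + w"
      by (simp add: Y_eq s.add invol)
    then have Xsw: "X (s w) = b *s s w - w"
      using w(2) by (simp add: s.scale)
    \<comment> \<open>By \<open>Xsw\<close> and X w = a w, X preserves the span of w and s w and is
      triangular there with diagonal entries a and b. The multiple of w is chosen to turn s w into
      an eigenvector for b, provided that the result is nonzero.\<close>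
    define u where "u = s w + inverse (a - b) *s w"
    have "a * inverse (a - b) - 1 = b * inverse (a - b)"
      using False by (simp add: field_simps)
    then have "(a * inverse (a - b)) *s w - w = (b * inverse (a - b)) *s w"
      by (metis scale_left_diff_distrib scale_one)
    then have Xu: "X u = b *s u"
      by (simp add: u_def X.add X.scale Xsw w(3) scale_right_distrib mult.commute algebra_simps)
    show ?thesis
    proof (cases "u = 0")
      case False
      then show ?thesis
        using Xu X by (auto simp: integral_op_def)
    next
      \<comment> \<open>Now s w is a multiple of w. As s is an involution, the factor is 1 or -1, so
        a and b differ by exactly 1.\<close>
      case True
      define r where "r = - inverse (a - b)"
      have sw: "s w = r *s w"
        using True by (simp add: u_def r_def eq_neg_iff_add_eq_0)
      have "w = s (s w)"
        by (simp add: invol)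
      also have "\<dots> = (r * r) *s w"
        by (simp add: sw s.scale)
      finally have "(r * r) *s w = 1 *s w"
        by simp
      then have "r * r = 1"
        using w(1) by (metis scale_right_imp_eq)
      then have "r = 1 \<or> r = - 1"
        by (simp add: square_eq_1_iff)
      then have "b = a + 1 \<or> b = a - 1"
        using \<open>a \<noteq> b\<close> by (auto simp: r_def field_simps)
      then show ?thesis
        using \<open>a \<in> \<int>\<close> by auto
    qed
  qed
qed

end

section \<open>Sums of transpositions along the edges of a graph\<close>

definition fun_scale :: "complex \<Rightarrow> ('a \<Rightarrow> complex) \<Rightarrow> 'a \<Rightarrow> complex" where
  "fun_scale c f = (\<lambda>x. c * f x)"

lemma fun_scale_apply [simp]: "fun_scale c f x = c * f x"
  by (simp add: fun_scale_def)

lemma minus_fun_apply' [simp]: "(f - g :: 'a \<Rightarrow> 'b::group_add) x = f x - g x"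
  by (simp add: fun_diff_def)

lemma sum_fun_apply: "(\<Sum>i\<in>I. f i :: 'a \<Rightarrow> 'b::comm_monoid_add) x = (\<Sum>i\<in>I. f i x)"
  by (induction I rule: infinite_finite_induct) auto

text \<open>
  Functions are not restricted to permutations of \<open>S\<close>: the span of an orbit is finite-dimensional
  for every \<open>f\<close>, and this is all that is needed to obtain eigenvectors.
\<close>

definition orbit_fun :: "'a set \<Rightarrow> (('a \<Rightarrow> 'a) \<Rightarrow> complex) \<Rightarrow> (('a \<Rightarrow> 'a) \<Rightarrow> complex) set" where
  "orbit_fun S f = (\<lambda>\<sigma> g. f (\<sigma> \<circ> g)) ` {\<sigma>. \<sigma> permutes S}"

interpretation fun_space: complex_vector_space fun_scale
  by standard (auto simp: fun_eq_iff algebra_simps)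

text \<open>
  The factor \<open>1 / 2\<close> compensates for the two arcs of an edge.  The intersection with \<open>S \<times> S\<close> is
  there because the graphs \<open>G\<^sub>i\<close> in a weak join may have vertices outside the graph that they build.
\<close>

definition trans_op :: "'a set \<Rightarrow> ('a \<times> 'a) set \<Rightarrow> (('a \<Rightarrow> 'a) \<Rightarrow> complex) \<Rightarrow> ('a \<Rightarrow> 'a) \<Rightarrow> complex" where
  "trans_op S E f g = (\<Sum>(i, j) \<in> E \<inter> S \<times> S. f (Transposition.transpose i j \<circ> g)) / 2"

definition complete_arcs :: "'a set \<Rightarrow> ('a \<times> 'a) set" where
  "complete_arcs V = {(u, v). u \<in> V \<and> v \<in> V \<and> u \<noteq> v}"

text \<open>Under \<open>trans_op\<close> this becomes a Jucys-Murphy element: the sum of the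
  transpositions exchanging \<open>x\<close> with a point of \<open>A\<close>.\<close>

definition star_arcs :: "'a set \<Rightarrow> 'a \<Rightarrow> ('a \<times> 'a) set" where
  "star_arcs A x = A \<times> {x} \<union> {x} \<times> A"

lemma trans_op_empty: "trans_op S {} = (\<lambda>f. 0)"
  by (simp add: trans_op_def fun_eq_iff)

lemma disjoint_family_on_arcs:
  assumes "disjoint_family_on V I" "\<And>i. i \<in> I \<Longrightarrow> E i \<subseteq> V i \<times> V i"
  shows "disjoint_family_on E I"
  using assms unfolding disjoint_family_on_def by blast

definition join_arcs :: "'i set \<Rightarrow> ('i \<Rightarrow> 'a set) \<Rightarrow> ('a \<times> 'a) set" where
  "join_arcs I V = {(u, v). \<exists>i\<in>I. \<exists>j\<in>I. i \<noteq> j \<and> u \<in> V i \<and> v \<in> V j}"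

lemma complete_arcs_UN:
  assumes "disjoint_family_on V I"
  shows "complete_arcs (\<Union>i\<in>I. V i) = join_arcs I V \<union> (\<Union>i\<in>I. complete_arcs (V i))"
proof (intro equalityI subrelI)
  fix u v assume "(u, v) \<in> complete_arcs (\<Union>i\<in>I. V i)"
  then obtain i j where "i \<in> I" "j \<in> I" "u \<in> V i" "v \<in> V j" "u \<noteq> v"
    by (auto simp: complete_arcs_def)
  then show "(u, v) \<in> join_arcs I V \<union> (\<Union>i\<in>I. complete_arcs (V i))"
    by (cases "i = j") (auto simp: complete_arcs_def join_arcs_def)
next
  fix u v assume "(u, v) \<in> join_arcs I V \<union> (\<Union>i\<in>I. complete_arcs (V i))"
  then consider i j where "i \<in> I" "j \<in> I" "i \<noteq> j" "u \<in> V i" "v \<in> V j"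
    | i where "i \<in> I" "(u, v) \<in> complete_arcs (V i)"
    unfolding join_arcs_def by blast
  then show "(u, v) \<in> complete_arcs (\<Union>i\<in>I. V i)"
  proof cases
    case 1
    then have "V i \<inter> V j = {}"
      using assms by (simp add: disjoint_family_on_def)
    then have "u \<noteq> v"
      using 1 by blast
    then show ?thesis
      using 1 by (auto simp: complete_arcs_def)
  qed (auto simp: complete_arcs_def)
qed

lemma join_arcs_disjoint:
  assumes "disjoint_family_on V I"
  shows "join_arcs I V \<inter> (\<Union>i\<in>I. V i \<times> V i) = {}"
proof -
  have "i = j" if "i \<in> I" "j \<in> I" "u \<in> V i" "u \<in> V j" for i j u
    using assms that unfolding disjoint_family_on_def by blast
  then show ?thesis
    unfolding join_arcs_def by blast
qed

section \<open>Edge operators over a finite ground set and their commutation\<close>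

locale finite_ground =
  fixes S :: "'a set"
  assumes finite_S: "finite S"

sublocale finite_ground \<subseteq> ops: locally_finite_space fun_scale "orbit_fun S"
proof
  fix f :: "('a \<Rightarrow> 'a) \<Rightarrow> complex"
  show "finite (orbit_fun S f)"
    by (simp add: orbit_fun_def finite_permutations finite_S)
  have "f = (\<lambda>g. f (id \<circ> g))"
    by simp
  then show "f \<in> orbit_fun S f"
    unfolding orbit_fun_def using permutes_id by blast
qed

context finite_ground
begin

text \<open>Applied to f(\<sigma> g), a transposition of two points of \<open>S\<close> gives
  f(\<sigma> (i j) g), which is again in the orbit of f. The arcs outside \<open>S\<close> could
  leave the orbit; \<open>trans_op\<close> discards them.\<close>

lemma adapted_trans_op: "ops.adapted (trans_op S E)"
  unfolding ops.adapted_def Vector_Spaces.linear_iff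
proof (intro conjI allI ballI)
  fix f h assume h: "h \<in> orbit_fun S f"
  then obtain \<sigma> where \<sigma>: "\<sigma> permutes S" "h = (\<lambda>g. f (\<sigma> \<circ> g))"
    by (auto simp: orbit_fun_def)
  have "(\<lambda>g. h (Transposition.transpose i j \<circ> g)) \<in> orbit_fun S f" if "i \<in> S" "j \<in> S" for i j
  proof -
    have "\<sigma> \<circ> Transposition.transpose i j permutes S"
      using that \<sigma>(1) by (intro permutes_compose permutes_swap_id)
    then show ?thesis
      unfolding orbit_fun_def using \<sigma>(2)
      by (intro image_eqI[of _ _ "\<sigma> \<circ> Transposition.transpose i j"]) (auto simp: comp_assoc)
  qed
  then have "fun_scale (1 / 2) (\<Sum>(i, j) \<in> E \<inter> S \<times> S. (\<lambda>g. h (Transposition.transpose i j \<circ> g)))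
      \<in> ops.span (orbit_fun S f)"
    by (intro ops.span_scale ops.span_sum) (auto intro: ops.span_base)
  also have "fun_scale (1 / 2) (\<Sum>(i, j) \<in> E \<inter> S \<times> S. (\<lambda>g. h (Transposition.transpose i j \<circ> g)))
      = trans_op S E h"
    by (auto simp: fun_eq_iff trans_op_def sum_fun_apply case_prod_beta)
  finally show "trans_op S E h \<in> ops.span (orbit_fun S f)" .
qed (use ops.vector_space_axioms in
  \<open>auto simp: fun_eq_iff trans_op_def sum.distrib sum_distrib_left case_prod_beta add_divide_distrib\<close>)

lemma linear_trans_op: "Vector_Spaces.linear fun_scale fun_scale (trans_op S E)"
  using adapted_trans_op by (rule ops.adapted_linear)

lemma trans_op_Un:
  assumes "E \<inter> E' = {}"
  shows "trans_op S (E \<union> E') f = trans_op S E f + trans_op S E' f"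
proof
  fix g
  have "(E \<union> E') \<inter> S \<times> S = (E \<inter> S \<times> S) \<union> (E' \<inter> S \<times> S)"
    by blast
  then show "trans_op S (E \<union> E') f g = (trans_op S E f + trans_op S E' f) g"
    using finite_S assms
    by (simp add: trans_op_def add_divide_distrib sum.union_disjoint disjoint_iff)
qed

lemma trans_op_UN:
  assumes "finite I" "disjoint_family_on E I"
  shows "trans_op S (\<Union>i\<in>I. E i) f = (\<Sum>i\<in>I. trans_op S (E i) f)"
  using assms
proof (induction I rule: finite_induct)
  case (insert k I)
  then have "E k \<inter> (\<Union>i\<in>I. E i) = {}" "disjoint_family_on E I"
    by (auto simp: disjoint_family_on_def)
  then show ?case
    using insert by (simp add: trans_op_Un)
qed (simp add: trans_op_empty)

lemma trans_op_commute:
  assumes "\<And>i j a b. (i, j) \<in> E \<Longrightarrow> (a, b) \<in> E' \<Longrightarrow>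
    Transposition.transpose i j \<circ> Transposition.transpose a b
      = Transposition.transpose a b \<circ> Transposition.transpose i j"
  shows "trans_op S E (trans_op S E' f) = trans_op S E' (trans_op S E f)"
proof
  fix g :: "'a \<Rightarrow> 'a"
  have "Transposition.transpose a b \<circ> (Transposition.transpose i j \<circ> g)
      = Transposition.transpose i j \<circ> (Transposition.transpose a b \<circ> g)"
    if "(i, j) \<in> E" "(a, b) \<in> E'" for i j a b
    using assms[OF that] by (metis comp_assoc)
  then have "(\<Sum>(i, j)\<in>E \<inter> S \<times> S. \<Sum>(a, b)\<in>E' \<inter> S \<times> S.
        f (Transposition.transpose a b \<circ> (Transposition.transpose i j \<circ> g)))
      = (\<Sum>(i, j)\<in>E \<inter> S \<times> S. \<Sum>(a, b)\<in>E' \<inter> S \<times> S.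
        f (Transposition.transpose i j \<circ> (Transposition.transpose a b \<circ> g)))"
    by (intro sum.cong refl) (auto intro!: sum.cong)
  also have "\<dots> = (\<Sum>(a, b)\<in>E' \<inter> S \<times> S. \<Sum>(i, j)\<in>E \<inter> S \<times> S.
        f (Transposition.transpose i j \<circ> (Transposition.transpose a b \<circ> g)))"
    unfolding case_prod_beta by (rule sum.swap)
  finally show "trans_op S E (trans_op S E' f) g = trans_op S E' (trans_op S E f) g"
    by (simp add: trans_op_def case_prod_beta flip: sum_divide_distrib)
qed

lemma trans_op_commute_disjoint:
  assumes "E \<subseteq> V \<times> V" "E' \<subseteq> V' \<times> V'" "V \<inter> V' = {}"
  shows "trans_op S E (trans_op S E' f) = trans_op S E' (trans_op S E f)"
proof (rule trans_op_commute)
  fix i j a b assume "(i, j) \<in> E" "(a, b) \<in> E'"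
  then have "i \<in> V" "j \<in> V" "a \<notin> V" "b \<notin> V"
    using assms by auto
  then have "i \<noteq> a" "i \<noteq> b" "j \<noteq> a" "j \<noteq> b"
    by blast+
  then show "Transposition.transpose i j \<circ> Transposition.transpose a b
      = Transposition.transpose a b \<circ> Transposition.transpose i j"
    by (auto simp: fun_eq_iff Transposition.transpose_def)
qed

text \<open>Conjugation by a transposition t = (i j) with i, j in \<open>V\<close> maps (a b) to
  (t(a) t(b)) and so permutes the edges of the complete graph on \<open>V\<close>. The sum over
  these edges therefore commutes with t.\<close>

lemma trans_op_complete_commute:
  assumes "E \<subseteq> V \<times> V"
  shows "trans_op S (complete_arcs V) (trans_op S E f) = trans_op S E (trans_op S (complete_arcs V) f)"
proof
  fix g
  let ?K = "complete_arcs V \<inter> S \<times> S"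
  have "(\<Sum>(a, b)\<in>?K. f (Transposition.transpose i j \<circ> (Transposition.transpose a b \<circ> g)))
      = (\<Sum>(a, b)\<in>?K. f (Transposition.transpose a b \<circ> (Transposition.transpose i j \<circ> g)))"
    if "(i, j) \<in> E \<inter> S \<times> S" for i j
  proof -
    define t where "t = Transposition.transpose i j"
    have ij: "i \<in> V" "j \<in> V" "i \<in> S" "j \<in> S"
      using that assms by auto
    have tt: "t (t a) = a" "t a = t b \<longleftrightarrow> a = b" for a b
      by (auto simp: t_def dest: transpose_eq_imp_eq)
    have t_in: "t a \<in> V \<longleftrightarrow> a \<in> V" "t a \<in> S \<longleftrightarrow> a \<in> S" for a
      using ij by (auto simp: t_def Transposition.transpose_def)
    have conj: "Transposition.transpose (t a) (t b) \<circ> t = t \<circ> Transposition.transpose a b" for a b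
      using transpose_comp_eq[of t "t a" "t b"] by (simp add: t_def)
    have "(\<Sum>(a, b)\<in>?K. f (t \<circ> (Transposition.transpose a b \<circ> g)))
        = (\<Sum>(a, b)\<in>?K. f (Transposition.transpose a b \<circ> (t \<circ> g)))"
      by (rule sum.reindex_bij_witness[of _ "map_prod t t" "map_prod t t"])
        (auto simp: tt t_in complete_arcs_def conj simp flip: comp_assoc)
    then show ?thesis
      by (simp add: t_def)
  qed
  then have "(\<Sum>(i, j)\<in>E \<inter> S \<times> S. \<Sum>(a, b)\<in>?K.
        f (Transposition.transpose a b \<circ> (Transposition.transpose i j \<circ> g)))
      = (\<Sum>(i, j)\<in>E \<inter> S \<times> S. \<Sum>(a, b)\<in>?K.
        f (Transposition.transpose i j \<circ> (Transposition.transpose a b \<circ> g)))"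
    by (intro sum.cong refl) auto
  also have "\<dots> = (\<Sum>(a, b)\<in>?K. \<Sum>(i, j)\<in>E \<inter> S \<times> S.
        f (Transposition.transpose i j \<circ> (Transposition.transpose a b \<circ> g)))"
    unfolding case_prod_beta by (rule sum.swap)
  finally show "trans_op S (complete_arcs V) (trans_op S E f) g
      = trans_op S E (trans_op S (complete_arcs V) f) g"
    by (simp add: trans_op_def case_prod_beta flip: sum_divide_distrib)
qed

section \<open>Integrality of stars and complete graphs\<close>

lemma trans_op_star:
  assumes "insert x A \<subseteq> S" "x \<notin> A"
  shows "trans_op S (star_arcs A x) f g = (\<Sum>i\<in>A. f (Transposition.transpose i x \<circ> g))"
proof -
  have fin: "finite A"
    using assms by (auto intro: finite_subset[OF _ finite_S])
  have "star_arcs A x \<inter> S \<times> S = A \<times> {x} \<union> {x} \<times> A"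
    using assms by (auto simp: star_arcs_def)
  moreover have "A \<times> {x} \<inter> {x} \<times> A = {}"
    using assms by auto
  moreover have "{x} \<times> A = (\<lambda>i. (x, i)) ` A" "A \<times> {x} = (\<lambda>i. (i, x)) ` A"
    by auto
  ultimately show ?thesis
    using fin by (simp add: trans_op_def sum.union_disjoint sum.reindex inj_on_def transpose_commute[of x])
qed

lemma trans_op_complete_insert:
  assumes "x \<notin> A"
  shows "trans_op S (complete_arcs (insert x A)) f
    = trans_op S (complete_arcs A) f + trans_op S (star_arcs A x) f"
proof -
  have "complete_arcs (insert x A) = complete_arcs A \<union> star_arcs A x"
    using assms by (auto simp: complete_arcs_def star_arcs_def)
  moreover have "complete_arcs A \<inter> star_arcs A x = {}"
    using assms by (auto simp: complete_arcs_def star_arcs_def)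
  ultimately show ?thesis
    by (simp add: trans_op_Un)
qed

text \<open>The star is the difference of the complete graphs on \<open>insert x A\<close> and on
  \<open>A\<close>, and both of these commute with all edges inside \<open>A\<close>.\<close>

lemma trans_op_star_commute:
  assumes "x \<notin> A" "E \<subseteq> A \<times> A"
  shows "trans_op S (star_arcs A x) (trans_op S E f) = trans_op S E (trans_op S (star_arcs A x) f)"
proof -
  interpret E: Vector_Spaces.linear fun_scale fun_scale "trans_op S E"
    by (rule linear_trans_op)
  have star: "trans_op S (star_arcs A x) h
      = trans_op S (complete_arcs (insert x A)) h - trans_op S (complete_arcs A) h" for h
    using trans_op_complete_insert[OF assms(1)] by simp
  have "E \<subseteq> insert x A \<times> insert x A"
    using assms by blast
  then show ?thesis
    using assms(2) by (simp add: star E.diff trans_op_complete_commute)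
qed

text \<open>Induction on the leaves. Conjugating the star of y over B by (y x) gives the star of x
  over B; adding the edge (y x) gives the star of x over \<open>insert y B\<close>. The centre
  changes from x to y, so the induction is over all centres.\<close>

lemma integral_star:
  assumes "insert x A \<subseteq> S" "x \<notin> A"
  shows "ops.integral_op (trans_op S (star_arcs A x))"
proof -
  have "finite A"
    using assms by (auto intro: finite_subset[OF _ finite_S])
  then show ?thesis
    using assms
  proof (induction A arbitrary: x rule: finite_induct)
    case empty
    have "star_arcs {} x = {}"
      by (simp add: star_arcs_def)
    then show ?case
      by (simp only: trans_op_empty ops.integral_op_zero)
  next
    case (insert y B)
    define s where "s f = (\<lambda>g. f (Transposition.transpose y x \<circ> g))" for f :: "('a \<Rightarrow> 'a) \<Rightarrow> complex"
    have B: "y \<notin> B" "insert y B \<subseteq> S" "x \<noteq> y" "x \<notin> B" "x \<in> S"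
      using insert by auto
    show ?case
    proof (rule ops.integral_op_conjugate_add)
      show "ops.integral_op (trans_op S (star_arcs B y))"
        using insert.IH B by blast
      show "ops.adapted (trans_op S (star_arcs (insert y B) x))"
        by (rule adapted_trans_op)
      show "Vector_Spaces.linear fun_scale fun_scale s"
        using ops.vector_space_axioms by (auto simp: s_def Vector_Spaces.linear_iff fun_eq_iff)
      show "s (s v) = v" for v
        by (simp add: s_def flip: comp_assoc)
      show "trans_op S (star_arcs (insert y B) x) v = s (trans_op S (star_arcs B y) (s v)) + s v" for v
      proof
        fix g :: "'a \<Rightarrow> 'a"
        \<comment> \<open>The identity (y x)(i y)(y x) = (i x) moves the centre of the star; the
          summand s v supplies the edge yx.\<close>
        have "Transposition.transpose y x \<circ> (Transposition.transpose i y \<circ> (Transposition.transpose y x \<circ> g))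
            = Transposition.transpose i x \<circ> g" if "i \<in> B" for i
          using that B transpose_comp_triple[of x i y] by (metis comp_assoc transpose_commute)
        then show "trans_op S (star_arcs (insert y B) x) v g = (s (trans_op S (star_arcs B y) (s v)) + s v) g"
          using B insert.hyps by (simp add: trans_op_star s_def)
      qed
      show "trans_op S (star_arcs B y) (trans_op S (star_arcs (insert y B) x) v)
          = trans_op S (star_arcs (insert y B) x) (trans_op S (star_arcs B y) v)" for v
        using B by (intro trans_op_star_commute[symmetric]) (auto simp: star_arcs_def)
    qed
  qed
qed

lemma integral_complete: "ops.integral_op (trans_op S (complete_arcs V))"
proof -
  have "ops.integral_op (trans_op S (complete_arcs A))" if "A \<subseteq> S" for A
    using finite_subset[OF that finite_S] that
  proof (induction A rule: finite_induct)
    case empty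
    have "complete_arcs {} = ({} :: ('a \<times> 'a) set)"
      by (simp add: complete_arcs_def)
    then show ?case
      by (simp only: trans_op_empty ops.integral_op_zero)
  next
    case (insert x A)
    \<comment> \<open>Adding the vertex x adds its star over A, which commutes with all edges inside
      A.\<close>
    have "ops.integral_op (\<lambda>f. trans_op S (complete_arcs A) f + trans_op S (star_arcs A x) f)"
    proof (rule ops.integral_op_add)
      show "ops.integral_op (trans_op S (complete_arcs A))"
        using insert by blast
      show "ops.integral_op (trans_op S (star_arcs A x))"
        using insert by (intro integral_star)
    qed (use insert.hyps in \<open>auto simp: complete_arcs_def intro!: trans_op_star_commute[symmetric]\<close>)
    moreover have "trans_op S (complete_arcs (insert x A))
        = (\<lambda>f. trans_op S (complete_arcs A) f + trans_op S (star_arcs A x) f)"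
      using insert.hyps by (intro ext trans_op_complete_insert)
    ultimately show ?case
      by (simp only:)
  qed
  \<comment> \<open>The induction covers subsets of \<open>S\<close>; for arbitrary
    \<open>V\<close>, possibly infinite, only the arcs inside \<open>S\<close> count.\<close>
  then have "ops.integral_op (trans_op S (complete_arcs (V \<inter> S)))"
    by simp
  also have "trans_op S (complete_arcs (V \<inter> S)) = trans_op S (complete_arcs V)"
    by (auto simp: trans_op_def complete_arcs_def fun_eq_iff intro!: sum.cong)
  finally show ?thesis .
qed

section \<open>Integrality of disjoint unions and joins\<close>

lemma integral_disjoint_union:
  assumes "finite I" "disjoint_family_on V I" "\<And>i. i \<in> I \<Longrightarrow> E i \<subseteq> V i \<times> V i"
    and "\<And>i. i \<in> I \<Longrightarrow> ops.integral_op (trans_op S (E i))"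
  shows "ops.integral_op (trans_op S (\<Union>i\<in>I. E i))"
proof -
  have "disjoint_family_on E I"
    using assms(2,3) by (rule disjoint_family_on_arcs)
  then have "trans_op S (\<Union>i\<in>I. E i) = (\<lambda>f. \<Sum>i\<in>I. trans_op S (E i) f)"
    using assms(1) by (intro ext) (simp add: trans_op_UN)
  moreover have "trans_op S (E i) (trans_op S (E j) f) = trans_op S (E j) (trans_op S (E i) f)"
    if "i \<in> I" "j \<in> I" for i j f
  proof (cases "i = j")
    case False
    then have "V i \<inter> V j = {}"
      using that assms(2) by (auto simp: disjoint_family_on_def)
    then show ?thesis
      using that assms(3) by (intro trans_op_commute_disjoint)
  qed simp
  ultimately show ?thesis
    using assms(1,4) by (simp only:) (rule ops.integral_op_sum)
qed

text \<open>In the complete graph on the union of the \<open>V i\<close>, replace each complete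
  graph on \<open>V i\<close> by \<open>E i\<close>. All operators involved commute: the large
  complete graph with everything inside it, the complete graph on \<open>V i\<close> with
  \<open>E i\<close>, and operators on different parts because the parts are disjoint.\<close>

lemma integral_join:
  assumes I: "finite I" and disj: "disjoint_family_on V I"
    and E: "\<And>i. i \<in> I \<Longrightarrow> E i \<subseteq> complete_arcs (V i)"
    and int: "\<And>i. i \<in> I \<Longrightarrow> ops.integral_op (trans_op S (E i))"
  shows "ops.integral_op (trans_op S ((\<Union>i\<in>I. E i) \<union> join_arcs I V))"
proof -
  define J where "J = join_arcs I V"
  define K where "K i = complete_arcs (V i)" for i
  define C where "C = complete_arcs (\<Union>i\<in>I. V i)"
  have K: "K i \<subseteq> V i \<times> V i" for i
    by (auto simp: K_def complete_arcs_def)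
  have sub: "K i \<subseteq> (\<Union>i\<in>I. V i) \<times> (\<Union>i\<in>I. V i)" "E i \<subseteq> (\<Union>i\<in>I. V i) \<times> (\<Union>i\<in>I. V i)" "E i \<subseteq> V i \<times> V i"
    if "i \<in> I" for i
    using that K[of i] E[of i] by (auto simp: complete_arcs_def)
  have disjK: "disjoint_family_on K I" "disjoint_family_on E I"
    using disjoint_family_on_arcs[OF disj] K sub(3) by simp_all
  have "C = J \<union> (\<Union>i\<in>I. K i)"
    unfolding C_def J_def K_def using disj by (rule complete_arcs_UN)
  moreover have "J \<inter> (\<Union>i\<in>I. K i) = {}" "J \<inter> (\<Union>i\<in>I. E i) = {}"
    using join_arcs_disjoint[OF disj] K sub(3) unfolding J_def by blast+
  ultimately have "trans_op S ((\<Union>i\<in>I. E i) \<union> J)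
      = (\<lambda>f. trans_op S C f + (\<Sum>i\<in>I. trans_op S (E i) f - trans_op S (K i) f))"
    using I disjK by (intro ext) (simp add: trans_op_Un trans_op_UN Int_commute sum_subtractf)
  moreover have "ops.integral_op (\<lambda>f. trans_op S C f + (\<Sum>i\<in>I. trans_op S (E i) f - trans_op S (K i) f))"
  proof (intro ops.integral_op_add ops.integral_op_sum ops.integral_op_diff I int)
    show "ops.integral_op (trans_op S C)" "ops.integral_op (trans_op S (K i))" for i
      by (simp_all add: C_def K_def integral_complete)
    show "trans_op S (E i) (trans_op S (K i) f) = trans_op S (K i) (trans_op S (E i) f)" if "i \<in> I" for i f
      using sub(3)[OF that] by (simp add: K_def trans_op_complete_commute)
    note lin = linear_trans_op[THEN Vector_Spaces.linear.axioms(3), THEN module_hom.diff]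
      linear_trans_op[THEN Vector_Spaces.linear.axioms(3), THEN module_hom.sum]
    show "trans_op S C (\<Sum>i\<in>I. trans_op S (E i) f - trans_op S (K i) f)
        = (\<Sum>i\<in>I. trans_op S (E i) (trans_op S C f) - trans_op S (K i) (trans_op S C f))" for f
      using sub by (simp add: lin C_def trans_op_complete_commute)
    fix i j f assume ij: "i \<in> I" "j \<in> I"
    show "trans_op S (E i) (trans_op S (E j) f - trans_op S (K j) f)
        - trans_op S (K i) (trans_op S (E j) f - trans_op S (K j) f)
        = trans_op S (E j) (trans_op S (E i) f - trans_op S (K i) f)
        - trans_op S (K j) (trans_op S (E i) f - trans_op S (K i) f)"
    proof (cases "i = j")
      case False
      then have "V i \<inter> V j = {}"
        using disj ij by (auto simp: disjoint_family_on_def)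
      note comm = trans_op_commute_disjoint[OF _ _ this]
      note Ei = sub(3)[OF ij(1)] and Ej = sub(3)[OF ij(2)]
      show ?thesis
        by (simp add: lin comm[OF Ei Ej] comm[OF Ei K] comm[OF K Ej] comm[OF K K] algebra_simps)
    qed simp
  qed
  ultimately have "ops.integral_op (trans_op S ((\<Union>i\<in>I. E i) \<union> J))"
    by (simp only:)
  then show ?thesis
    unfolding J_def .
qed

end

section \<open>Generalized complete multipartite graphs\<close>

lemma UN_nth: "(\<Union>i<length xs. f (xs ! i)) = (\<Union>x\<in>set xs. f x)"
  by (force simp: set_conv_nth)

context finite_ground
begin

text \<open>A complete multipartite graph is the join of the edgeless graphs on its parts, and these
  have the zero operator. The parts serve as their own indices.\<close>

lemma integral_complete_multipartite:
  assumes "complete_multipartite G"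
  shows "ops.integral_op (trans_op S (parcs G))"
proof -
  obtain P where P: "pair_graph G" "partition_on (pverts G) P"
    "parcs G = {(u, v). \<exists>A\<in>P. \<exists>B\<in>P. A \<noteq> B \<and> u \<in> A \<and> v \<in> B}"
    using assms by (auto simp: complete_multipartite_def)
  interpret pair_graph G
    by (rule P(1))
  have "ops.integral_op (trans_op S ((\<Union>A\<in>P. {}) \<union> join_arcs P (\<lambda>A. A)))"
  proof (rule integral_join)
    show "finite P"
      using finite_elements[OF pair_finite_verts P(2)] .
    show "disjoint_family_on (\<lambda>A. A) P"
      using P(2) by (auto simp: disjoint_family_on_def partition_on_def disjoint_def)
  qed (simp_all only: trans_op_empty ops.integral_op_zero empty_subsetI)
  also have "(\<Union>A\<in>P. {}) \<union> join_arcs P (\<lambda>A. A) = parcs G"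
    by (simp add: P(3) join_arcs_def)
  finally show ?thesis .
qed

lemma integral_disjoint_union_of:
  assumes "disjoint_union_of Q G"
    and "\<And>C. Q C \<Longrightarrow> pair_graph C"
    and "\<And>C. Q C \<Longrightarrow> ops.integral_op (trans_op S (parcs C))"
  shows "ops.integral_op (trans_op S (parcs G))"
proof -
  obtain Cs where Cs: "\<forall>C\<in>set Cs. Q C" "vertex_disjoint Cs" "G = graph_union Cs"
    using assms(1) by (auto simp: disjoint_union_of_def)
  have "ops.integral_op (trans_op S (\<Union>i\<in>{..<length Cs}. parcs (Cs ! i)))"
  proof (rule integral_disjoint_union)
    show "disjoint_family_on (\<lambda>i. pverts (Cs ! i)) {..<length Cs}"
      using Cs(2) by (simp add: vertex_disjoint_def)
    fix i assume "i \<in> {..<length Cs}"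
    then have Q: "Q (Cs ! i)"
      using Cs(1) by simp
    interpret pair_graph "Cs ! i"
      using assms(2)[OF Q] .
    show "parcs (Cs ! i) \<subseteq> pverts (Cs ! i) \<times> pverts (Cs ! i)"
      using arc_fst_in_verts arc_snd_in_verts by fastforce
    show "ops.integral_op (trans_op S (parcs (Cs ! i)))"
      using assms(3)[OF Q] .
  qed simp
  also have "(\<Union>i\<in>{..<length Cs}. parcs (Cs ! i)) = parcs G"
    by (simp add: Cs(3) graph_union_def UN_nth[of parcs])
  finally show ?thesis .
qed

text \<open>The operator of a graph depends on its arcs only. So the vertices that are dropped in
  passing from \<open>Gs ! i\<close> to its subgraph, or from \<open>G\<close> to its non-isolated
  part, do not affect integrality.\<close>

lemma integral_weak_join:
  assumes "weak_join G Gs"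
    and "\<And>H. H \<in> set Gs \<Longrightarrow> ops.integral_op (trans_op S (parcs H))"
  shows "ops.integral_op (trans_op S (parcs G))"
proof -
  obtain \<Gamma>s where \<Gamma>s: "pair_graph G" "length \<Gamma>s = length Gs"
    "\<forall>i<length Gs. pair_graph (\<Gamma>s ! i) \<and> parcs (\<Gamma>s ! i) = parcs (Gs ! i)"
    "vertex_disjoint \<Gamma>s" "non_isolated_subgraph G = graph_join \<Gamma>s"
    using assms(1) by (auto simp: weak_join_def)
  interpret G: pair_graph G
    by (rule \<Gamma>s(1))
  let ?I = "{..<length \<Gamma>s}" and ?V = "\<lambda>i. pverts (\<Gamma>s ! i)"
  have "ops.integral_op (trans_op S ((\<Union>i\<in>?I. parcs (\<Gamma>s ! i)) \<union> join_arcs ?I ?V))"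
  proof (rule integral_join)
    show "disjoint_family_on ?V ?I"
      using \<Gamma>s(4) by (simp add: vertex_disjoint_def)
    fix i assume i: "i \<in> ?I"
    interpret pair_graph "\<Gamma>s ! i"
      using \<Gamma>s(2,3) i by auto
    show "parcs (\<Gamma>s ! i) \<subseteq> complete_arcs (?V i)"
      using arc_fst_in_verts arc_snd_in_verts pair_no_loops by (fastforce simp: complete_arcs_def)
    show "ops.integral_op (trans_op S (parcs (\<Gamma>s ! i)))"
      using assms(2) \<Gamma>s(2,3) i by (metis lessThan_iff nth_mem)
  qed simp
  also have "(\<Union>i\<in>?I. parcs (\<Gamma>s ! i)) \<union> join_arcs ?I ?V = parcs (graph_join \<Gamma>s)"
    by (simp add: graph_join_def graph_union_def join_arcs_def UN_nth[of parcs] Bex_def)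
  also have "\<dots> = parcs (non_isolated_subgraph G)"
    using \<Gamma>s(5) by simp
  also have "\<dots> = parcs G"
  proof (intro equalityI subrelI)
    \<comment> \<open>By symmetry both ends of an arc are non-isolated, so no arc is lost.\<close>
    fix u v assume uv: "(u, v) \<in> parcs G"
    then have "(v, u) \<in> parcs G" "u \<in> pverts G" "v \<in> pverts G"
      using G.arcs_symmetric G.arc_fst_in_verts G.arc_snd_in_verts by fastforce+
    then show "(u, v) \<in> parcs (non_isolated_subgraph G)"
      using uv unfolding non_isolated_subgraph_def non_isolated_def by auto
  qed (simp add: non_isolated_subgraph_def)
  finally show ?thesis .
qed

lemma integral_gen_complete_multipartite:
  assumes "gen_complete_multipartite k G"
  shows "ops.integral_op (trans_op S (parcs G))"
  using assms
proof (induction rule: gen_complete_multipartite.induct)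
  case (type_one G Gs)
  have "pair_graph C" if "complete_multipartite C" for C :: "'a pair_pre_digraph"
    using that by (simp add: complete_multipartite_def)
  then have "ops.integral_op (trans_op S (parcs H))" if "H \<in> set Gs" for H
    using integral_disjoint_union_of[OF bspec[OF type_one(2) that]] integral_complete_multipartite
    by blast
  then show ?case
    using type_one(1) by (rule integral_weak_join[rotated])
next
  case (type_ge_two m G Gs)
  have "pair_graph C" if "gen_complete_multipartite l C" for C :: "'a pair_pre_digraph" and l
    using that by cases (auto simp: weak_join_def)
  \<comment> \<open>By monotonicity of \<open>disjoint_union_of\<close>,
    \<open>type_ge_two(3)\<close> carries the induction hypothesis inside the predicate on the
    components.\<close>
  then have "ops.integral_op (trans_op S (parcs H))" if "H \<in> set Gs" for H
    using integral_disjoint_union_of[OF bspec[OF type_ge_two(3) that]] by blast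
  then show ?case
    using type_ge_two(2) by (rule integral_weak_join[rotated])
qed

end

section \<open>From the edge operator to the spectrum of the Cayley graph\<close>

lemma transpositionsE:
  assumes "t \<in> transpositions n"
  obtains i j where "t = Transposition.transpose i j" "i \<in> {1..n}" "j \<in> {1..n}" "i \<noteq> j"
  using assms unfolding transpositions_def by blast

lemma transposition_props:
  assumes "t \<in> transpositions n"
  shows "t permutes {1..n}" "t \<circ> t = id" "t \<noteq> id"
  using assms by (auto elim!: transpositionsE simp: transpose_eq_id_iff intro!: permutes_swap_id)

lemma transpose_eq_transposeD:
  assumes "Transposition.transpose i j = Transposition.transpose a b" "i \<noteq> j"
  shows "i = a \<and> j = b \<or> i = b \<and> j = a"
  using assms by (metis transpose_apply_first transpose_apply_other transpose_apply_second)

text \<open>Each transposition in \<open>T\<close> comes from exactly two arcs, the two orientations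
  of its edge. This is the factor that \<open>trans_op\<close> divides out.\<close>

lemma sum_transposition_graph_arcs:
  fixes F :: "(nat \<Rightarrow> nat) \<Rightarrow> complex"
  assumes "T \<subseteq> transpositions n"
  shows "(\<Sum>(i, j)\<in>parcs (transposition_graph n T). F (Transposition.transpose i j)) = 2 * (\<Sum>t\<in>T. F t)"
proof -
  let ?E = "parcs (transposition_graph n T)" and ?t = "\<lambda>p. Transposition.transpose (fst p) (snd p)"
  have fin: "finite ?E"
    by (rule finite_subset[of _ "{1..n} \<times> {1..n}"]) (auto simp: transposition_graph_def)
  have fiber: "{p \<in> ?E. ?t p = t} = {(a, b), (b, a)} \<and> a \<noteq> b"
    if "t \<in> T" "t = Transposition.transpose a b" "a \<in> {1..n}" "b \<in> {1..n}" "a \<noteq> b" for t a b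
  proof -
    have "{p \<in> ?E. ?t p = t} \<subseteq> {(a, b), (b, a)}"
    proof (rule subrelI)
      fix i j assume "(i, j) \<in> {p \<in> ?E. ?t p = t}"
      then have "Transposition.transpose i j = Transposition.transpose a b" "i \<noteq> j"
        using that(2) by (simp_all add: transposition_graph_def)
      then show "(i, j) \<in> {(a, b), (b, a)}"
        by (auto dest: transpose_eq_transposeD)
    qed
    moreover have "{(a, b), (b, a)} \<subseteq> {p \<in> ?E. ?t p = t}"
      using that by (auto simp: transposition_graph_def transpose_commute)
    ultimately show ?thesis
      using that(5) by blast
  qed
  have ex: "\<exists>a b. t = Transposition.transpose a b \<and> a \<in> {1..n} \<and> b \<in> {1..n} \<and> a \<noteq> b" if "t \<in> T" for t
    using subsetD[OF assms that] by (elim transpositionsE) blast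
  have T: "?t ` ?E = T"
  proof (intro equalityI subsetI)
    fix t assume "t \<in> T"
    then obtain a b where "t = Transposition.transpose a b" "a \<in> {1..n}" "b \<in> {1..n}" "a \<noteq> b"
      using ex by blast
    then have "t = ?t (a, b)" "(a, b) \<in> ?E"
      using \<open>t \<in> T\<close> by (auto simp: transposition_graph_def)
    then show "t \<in> ?t ` ?E"
      by (rule image_eqI)
  qed (auto simp: transposition_graph_def)
  have "(\<Sum>p\<in>?E. F (?t p)) = (\<Sum>t\<in>?t ` ?E. \<Sum>p\<in>{p \<in> ?E. ?t p = t}. F (?t p))"
    using fin by (rule sum.image_gen)
  also have "\<dots> = (\<Sum>t\<in>T. 2 * F t)"
    unfolding T
  proof (rule sum.cong)
    fix t assume "t \<in> T"
    then obtain a b where "t = Transposition.transpose a b" "a \<in> {1..n}" "b \<in> {1..n}" "a \<noteq> b"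
      using ex by blast
    with fiber[OF \<open>t \<in> T\<close> this] show "(\<Sum>p\<in>{p \<in> ?E. ?t p = t}. F (?t p)) = 2 * F t"
      by (simp add: transpose_commute[of b a])
  qed simp
  finally show ?thesis
    by (simp add: case_prod_beta sum_distrib_left)
qed

text \<open>Transpositions are involutions, so g h^-1 = t amounts to h = t g. Adjacency thereby
  takes the form of left multiplication, as in \<open>trans_op\<close>.\<close>

lemma parcs_cayley_sym_group:
  assumes "T \<subseteq> transpositions n"
  shows "(g, h) \<in> parcs (cayley_graph (sym_group n) T) \<longleftrightarrow> g permutes {1..n} \<and> (\<exists>t\<in>T. h = t \<circ> g)"
proof -
  have t: "t permutes {1..n} \<and> t \<circ> t = id" if "t \<in> T" for t
    using transposition_props[OF subsetD[OF assms that]] by blast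
  have "(g, h) \<in> parcs (cayley_graph (sym_group n) T)
      \<longleftrightarrow> g permutes {1..n} \<and> h permutes {1..n} \<and> g \<circ> inv' h \<in> T"
    by (auto simp: cayley_graph_def sym_group_carrier sym_group_mult sym_group_inv_equality)
  also have "\<dots> \<longleftrightarrow> g permutes {1..n} \<and> (\<exists>t\<in>T. h = t \<circ> g)"
  proof (intro iffI conjI; elim conjE bexE)
    assume gh: "g permutes {1..n}" "h permutes {1..n}" "g \<circ> inv' h \<in> T"
    have "(g \<circ> inv' h) \<circ> h = g"
      using permutes_inv_o(2)[OF gh(2)] by (simp add: comp_assoc)
    then have "h = (g \<circ> inv' h) \<circ> g"
      using t[OF gh(3)] by (metis comp_assoc id_comp)
    then show "\<exists>t\<in>T. h = t \<circ> g"
      using gh(3) by blast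
  next
    fix t assume g: "g permutes {1..n}" and "t \<in> T" "h = t \<circ> g"
    then show h: "h permutes {1..n}"
      using t permutes_compose by blast
    have "t \<circ> h = g"
      using t[OF \<open>t \<in> T\<close>] \<open>h = t \<circ> g\<close> by (metis comp_assoc id_comp)
    then have "g \<circ> inv' h = t"
      using permutes_inv_o(1)[OF h] by (metis comp_assoc comp_id)
    then show "g \<circ> inv' h \<in> T"
      using \<open>t \<in> T\<close> by simp
  qed auto
  finally show ?thesis .
qed

lemma pair_graph_cayley_sym_group:
  assumes "T \<subseteq> transpositions n"
  shows "pair_graph (cayley_graph (sym_group n) T)"
proof -
  let ?G = "cayley_graph (sym_group n) T"
  have t: "t permutes {1..n} \<and> t \<circ> t = id \<and> t \<noteq> id" if "t \<in> T" for t
    using transposition_props[OF subsetD[OF assms that]] by blast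
  have verts: "pverts ?G = {g. g permutes {1..n}}"
    by (simp add: cayley_graph_def sym_group_def)
  have arcs: "parcs ?G \<subseteq> pverts ?G \<times> pverts ?G"
    by (auto simp: cayley_graph_def)
  have "finite (pverts ?G)"
    by (simp add: verts finite_permutations)
  moreover have "sym (parcs ?G)"
  proof (rule symI)
    fix g h assume "(g, h) \<in> parcs ?G"
    then obtain t where "g permutes {1..n}" "t \<in> T" "h = t \<circ> g"
      by (auto simp: parcs_cayley_sym_group[OF assms])
    moreover from this have "h permutes {1..n}" "g = t \<circ> h"
      using t by (blast intro: permutes_compose, metis comp_assoc id_comp)
    ultimately show "(h, g) \<in> parcs ?G"
      unfolding parcs_cayley_sym_group[OF assms] by blast
  qed
  moreover have "g \<noteq> h" if "(g, h) \<in> parcs ?G" for g h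
  proof
    assume "g = h"
    with that have "(g, g) \<in> parcs ?G"
      by simp
    then obtain t where "g permutes {1..n}" "t \<in> T" "g = t \<circ> g"
      unfolding parcs_cayley_sym_group[OF assms] by blast
    then have "t = id"
      by (metis comp_assoc comp_id permutes_inv_o(1))
    then show False
      using t \<open>t \<in> T\<close> by blast
  qed
  ultimately show ?thesis
    using arcs finite_subset[OF arcs]
    by unfold_locales (auto simp: symmetric_def)
qed

theorem proposition3:
  fixes n k :: nat and T :: "(nat \<Rightarrow> nat) set"
  assumes "T \<subseteq> transpositions n"
    and "1 \<le> k"
    and "gen_complete_multipartite k (transposition_graph n T)"
  shows "integral_graph (cayley_graph (sym_group n) T)"
  unfolding integral_graph_def
proof (intro conjI allI impI subsetI; (elim conjE)?)
  show "pair_graph (cayley_graph (sym_group n) T)"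
    using assms(1) by (rule pair_graph_cayley_sym_group)
  interpret finite_ground "{1..n}"
    by standard simp
  let ?G = "cayley_graph (sym_group n) T" and ?E = "parcs (transposition_graph n T)"
  fix vs c
  assume vs: "distinct vs" "set vs = pverts ?G" and "c \<in> spectrum (adjacency_matrix ?G vs)"
  define N where "N = length vs"
  define A where "A = adjacency_matrix ?G vs"
  have A: "A \<in> carrier_mat N N"
    by (simp add: A_def adjacency_matrix_def N_def)
  obtain x where x: "x \<in> carrier_vec N" "x \<noteq> 0\<^sub>v N" "A *\<^sub>v x = c \<cdot>\<^sub>v x"
    using \<open>c \<in> _\<close> A by (auto simp: spectrum_def eigenvalue_def eigenvector_def A_def[symmetric])
  have set_vs: "set vs = {g. g permutes {1..n}}"
    using vs(2) by (simp add: cayley_graph_def sym_group_def)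
  \<comment> \<open>The eigenvector as a function on permutations, extended by 0 to all other
    functions. The \<open>THE\<close> inverts the enumeration \<open>vs\<close>.\<close>
  define f where "f g = (if g \<in> set vs then x $ (THE i. i < N \<and> vs ! i = g) else 0)" for g
  have f_nth: "f (vs ! i) = x $ i" if "i < N" for i
  proof -
    have "(THE j. j < N \<and> vs ! j = vs ! i) = i"
      using that vs(1) by (auto simp: N_def nth_eq_iff_index_eq)
    then show ?thesis
      using that by (simp add: f_def N_def)
  qed
  obtain i0 where "i0 < N" "x $ i0 \<noteq> 0"
    using x(1,2) by (metis carrier_vecD eq_vecI index_zero_vec)
  then have "f \<noteq> 0"
    using f_nth by (metis zero_fun_apply)
  have t: "t permutes {1..n} \<and> t \<circ> t = id" if "t \<in> T" for t
    using transposition_props[OF subsetD[OF assms(1) that]] by blast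
  have op: "trans_op {1..n} ?E f g = (\<Sum>t\<in>T. f (t \<circ> g))" for g
  proof -
    have "?E \<inter> {1..n} \<times> {1..n} = ?E"
      by (auto simp: transposition_graph_def)
    then show ?thesis
      using sum_transposition_graph_arcs[OF assms(1), of "\<lambda>t. f (t \<circ> g)"] by (simp add: trans_op_def)
  qed
  have "trans_op {1..n} ?E f = fun_scale c f"
  proof
    fix g
    show "trans_op {1..n} ?E f g = fun_scale c f g"
    proof (cases "g \<in> set vs")
      case True
      then obtain i where i: "i < N" "g = vs ! i"
        by (auto simp: in_set_conv_nth N_def)
      have g: "g permutes {1..n}"
        using True set_vs by simp
      \<comment> \<open>Row i of the eigenvector equation is rewritten as a sum over the neighbours
        of g, which are the t g with t in T, each arising from one t.\<close>
      have "c * f g = (A *\<^sub>v x) $ i"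
        using i x by (simp add: f_nth)
      also have "\<dots> = (\<Sum>j<N. A $$ (i, j) * x $ j)"
        using A i(1) x(1) by (simp add: scalar_prod_def atLeast0LessThan)
      also have "\<dots> = (\<Sum>j<N. (if (g, vs ! j) \<in> parcs ?G then f (vs ! j) else 0))"
        using i by (intro sum.cong) (auto simp: A_def adjacency_matrix_def N_def[symmetric] f_nth)
      also have "\<dots> = (\<Sum>h\<in>set vs. if (g, h) \<in> parcs ?G then f h else 0)"
        using vs(1) by (intro sum.reindex_bij_betw[of "(!) vs"] bij_betw_nth) (auto simp: N_def)
      also have "\<dots> = (\<Sum>h\<in>{h \<in> set vs. (g, h) \<in> parcs ?G}. f h)"
        by (simp add: sum.inter_filter)
      also have "{h \<in> set vs. (g, h) \<in> parcs ?G} = (\<lambda>t. t \<circ> g) ` T"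
        using g t permutes_compose by (fastforce simp: set_vs parcs_cayley_sym_group[OF assms(1)])
      also have "sum f ((\<lambda>t. t \<circ> g) ` T) = (\<Sum>t\<in>T. f (t \<circ> g))"
      proof -
        have "inj_on (\<lambda>t. t \<circ> g) T"
          by (rule inj_onI) (metis comp_assoc comp_id permutes_inv_o(1)[OF g])
        then show ?thesis
          by (simp add: sum.reindex)
      qed
      finally show ?thesis
        by (simp only: op fun_scale_apply)
    next
      case False
      \<comment> \<open>If g is not a permutation of {1..n}, neither is t g, since g = t (t g). So
        both sides of the equation vanish at g.\<close>
      have "t \<circ> g \<notin> set vs" if "t \<in> T" for t
      proof
        assume "t \<circ> g \<in> set vs"
        then have "t \<circ> (t \<circ> g) permutes {1..n}"
          using t[OF that] permutes_compose set_vs by blast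
        then show False
          using False t[OF that] set_vs by (simp flip: comp_assoc)
      qed
      then have "(\<Sum>t\<in>T. f (t \<circ> g)) = c * f g"
        using False by (simp add: f_def)
      then show ?thesis
        by (simp only: op fun_scale_apply)
    qed
  qed
  with integral_gen_complete_multipartite[OF assms(3)] \<open>f \<noteq> 0\<close> show "c \<in> \<int>"
    by (rule ops.integral_op_eigenvalue)
qed

end
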